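(* Let $k$ be a perfect field of characteristic $p>0$, let $n\ge 1$ and $\mathbf t=(t_1,\ldots,t_n)$ be indeterminates, and let $K$ be the field of fractions of $k[[\mathbf t]]$. Let $A(\mathbf t,y)$ be a nonzero polynomial in $k[\mathbf t,y]$ and let $f\in k[[\mathbf t]]$ satisfy $A(\mathbf t,f)=0$. Assume that $\deg_y(A)\le d$, that the total degree of $A$ in the variables $\mathbf t$ satisfies $\deg_{\mathbf t}(A)\le h$, and that $\deg_{t_i}(A)\le h_i$ for all $1\le i\le n$. Then there exists a $k$-vector space $W\subset K$ of dimension at most $$N:=(d+1)\cdot\min\left\{\prod_{i=1}^n(h_i+1),\ \binom{n+h}{n}\right\}$$ that contains $f$ and that is closed under the action of $\Omega_n$.
   Context: For $\mathbf i=(i_1,\ldots,i_n)$ write $\mathbf t^{\mathbf i}=t_1^{i_1}\cdots t_n^{i_n}$. Section operators: let $\mathsf F:K\to K$, $x\mapsto x^p$, be the Frobenius map (injective), and let $K^{\langle p\rangle}=\mathsf F(K)$. Since $k$ is perfect, $K$ is a $K^{\langle p\rangle}$-vector space of dimension $p^n$ with basis $\{\mathbf t^{\mathbf r}:\mathbf r\in\{0,\ldots,p-1\}^n\}$, so each $g\in K$ has a unique expansion $g=\sum_{\mathbf r\in\{0,\ldots,p-1\}^n}\mathbf t^{\mathbf r}g_{\mathbf r}$ with $g_{\mathbf r}\in K^{\langle p\rangle}$. For $\mathbf r\in\{0,\ldots,p-1\}^n$ the section operator $S_{\mathbf r}:K\to K$ is $S_{\mathbf r}(g):=\mathsf F^{-1}(g_{\mathbf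 r})$. $\Omega_n$ is the monoid generated by all $S_{\mathbf r}$, $\mathbf r\in\{0,\ldots,p-1\}^n$, under composition. *)

theory Defs
  imports
    "HOL-Library.Cardinality"
    "HOL-Library.FuncSet"
    "HOL-Library.Poly_Mapping"
    "HOL-Computational_Algebra.Polynomial"
    "HOL-Computational_Algebra.Fraction_Field"
begin

subsection \<open>Formal power series in several variables\<close>

text \<open>
  The indeterminates are indexed by the elements of a finite type \<open>'n\<close> (so their number is
  \<open>CARD('n)\<close>). An exponent vector is an element of \<open>'n \<Rightarrow>\<^sub>0 nat\<close>.
\<close>

typedef ('a, 'n) mfps = "UNIV :: (('n \<Rightarrow>\<^sub>0 nat) \<Rightarrow> 'a) set"
  morphisms mfps_nth Abs_mfps ..

setup_lifting type_definition_mfps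

lemma mfps_eqI: "(\<And>m. mfps_nth f m = mfps_nth g m) \<Longrightarrow> f = g"
  by (simp add: mfps_nth_inject[symmetric] fun_eq_iff)

lemma finite_exponents_le:
  "finite {a :: 'n::finite \<Rightarrow>\<^sub>0 nat. \<forall>i. Poly_Mapping.lookup a i \<le> b i}"
proof (rule finite_imageD)
  have "Poly_Mapping.lookup ` {a :: 'n \<Rightarrow>\<^sub>0 nat. \<forall>i. Poly_Mapping.lookup a i \<le> b i}
      \<subseteq> (\<Pi>\<^sub>E i\<in>UNIV. {..b i})"
    by (auto simp: PiE_def)
  then show "finite (Poly_Mapping.lookup ` {a :: 'n \<Rightarrow>\<^sub>0 nat. \<forall>i. Poly_Mapping.lookup a i \<le> b i})"
    by (rule finite_subset) (simp add: finite_PiE)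
qed (simp add: inj_on_def)

lemma finite_exponent_splits:
  "finite {(a, b). a + b = (m :: 'n::finite \<Rightarrow>\<^sub>0 nat)}"
proof -
  let ?B = "{a :: 'n \<Rightarrow>\<^sub>0 nat. \<forall>i. Poly_Mapping.lookup a i \<le> Poly_Mapping.lookup m i}"
  have "{(a, b). a + b = m} \<subseteq> ?B \<times> ?B"
    by (auto simp: lookup_add)
  then show ?thesis
    by (rule finite_subset) (intro finite_cartesian_product finite_exponents_le)
qed

instantiation mfps :: (comm_ring_1, finite) comm_ring_1
begin

lift_definition zero_mfps :: "('a, 'b) mfps" is "\<lambda>_. 0" .
lift_definition one_mfps :: "('a, 'b) mfps" is "\<lambda>m. if m = 0 then 1 else 0" .
lift_definition plus_mfps :: "('a, 'b) mfps \<Rightarrow> ('a, 'b) mfps \<Rightarrow> ('a, 'b) mfps"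
  is "\<lambda>f g m. f m + g m" .
lift_definition minus_mfps :: "('a, 'b) mfps \<Rightarrow> ('a, 'b) mfps \<Rightarrow> ('a, 'b) mfps"
  is "\<lambda>f g m. f m - g m" .
lift_definition uminus_mfps :: "('a, 'b) mfps \<Rightarrow> ('a, 'b) mfps"
  is "\<lambda>f m. - f m" .
lift_definition times_mfps :: "('a, 'b) mfps \<Rightarrow> ('a, 'b) mfps \<Rightarrow> ('a, 'b) mfps"
  is "\<lambda>f g m. \<Sum>(a, b) \<in> {(a, b). a + b = m}. f a * g b" .

instance
proof
  fix f g h :: "('a, 'b) mfps"
  show "f * g * h = f * (g * h)"
  proof (rule mfps_eqI)
    fix m :: "'b \<Rightarrow>\<^sub>0 nat"
    let ?D = "\<lambda>m :: 'b \<Rightarrow>\<^sub>0 nat. {(a, b). a + b = m}"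
    let ?F = "mfps_nth f" and ?G = "mfps_nth g" and ?H = "mfps_nth h"
    have "mfps_nth (f * g * h) m
        = (\<Sum>s\<in>?D m. \<Sum>u\<in>?D (fst s). ?F (fst u) * ?G (snd u) * ?H (snd s))"
      by (simp add: times_mfps.rep_eq case_prod_beta sum_distrib_right)
    also have "\<dots> = (\<Sum>(s, u)\<in>(SIGMA s:?D m. ?D (fst s)). ?F (fst u) * ?G (snd u) * ?H (snd s))"
      by (intro sum.Sigma) (auto intro: finite_exponent_splits)
    also have "\<dots> = (\<Sum>(s, u)\<in>(SIGMA s:?D m. ?D (snd s)). ?F (fst s) * ?G (fst u) * ?H (snd u))"
      by (rule sum.reindex_bij_witness
          [where i = "\<lambda>(s, u). ((fst s + fst u, snd u), (fst s, fst u))"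
             and j = "\<lambda>(s, u). ((fst u, snd u + snd s), (snd u, snd s))"])
         (auto simp: add.assoc)
    also have "\<dots> = (\<Sum>s\<in>?D m. \<Sum>u\<in>?D (snd s). ?F (fst s) * ?G (fst u) * ?H (snd u))"
      by (intro sum.Sigma[symmetric]) (auto intro: finite_exponent_splits)
    also have "\<dots> = mfps_nth (f * (g * h)) m"
      by (simp add: times_mfps.rep_eq case_prod_beta sum_distrib_left mult.assoc)
    finally show "mfps_nth (f * g * h) m = mfps_nth (f * (g * h)) m" .
  qed
  show "f * g = g * f"
  proof (rule mfps_eqI)
    fix m :: "'b \<Rightarrow>\<^sub>0 nat"
    show "mfps_nth (f * g) m = mfps_nth (g * f) m"
      unfolding times_mfps.rep_eq
      by (rule sum.reindex_bij_witness[where i = prod.swap and j = prod.swap])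
         (auto simp: add.commute mult.commute)
  qed
  show "1 * f = f"
  proof (rule mfps_eqI)
    fix m :: "'b \<Rightarrow>\<^sub>0 nat"
    have "mfps_nth (1 * f) m
        = (\<Sum>s\<in>{(a, b). a + b = m}. if s = (0, m) then mfps_nth f m else 0)"
      unfolding times_mfps.rep_eq one_mfps.rep_eq
      by (rule sum.cong) (auto split: if_splits)
    also have "\<dots> = mfps_nth f m"
      by (simp add: finite_exponent_splits)
    finally show "mfps_nth (1 * f) m = mfps_nth f m" .
  qed
  show "(f + g) * h = f * h + g * h"
    by (rule mfps_eqI)
       (simp add: times_mfps.rep_eq plus_mfps.rep_eq case_prod_beta distrib_right sum.distrib)
  show "(0 :: ('a, 'b) mfps) \<noteq> 1"
    by transfer (auto simp: fun_eq_iff)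
qed (transfer; auto simp: fun_eq_iff algebra_simps)+

end

lemma exponent_corner:
  fixes A B :: "('n \<Rightarrow>\<^sub>0 nat) set"
  assumes "A \<noteq> {}" "B \<noteq> {}"
  shows "\<exists>a\<in>A. \<exists>b\<in>B. \<forall>u\<in>A. \<forall>v\<in>B. u + v = a + b \<longrightarrow>
           (\<forall>i\<in>set is. Poly_Mapping.lookup u i = Poly_Mapping.lookup a i)"
  using assms
proof (induction "is" arbitrary: A B)
  case Nil
  then show ?case by auto
next
  case (Cons x xs)
  let ?l = "\<lambda>u :: 'n \<Rightarrow>\<^sub>0 nat. Poly_Mapping.lookup u x"
  define p where "p = (LEAST k. k \<in> ?l ` A)"
  define q where "q = (LEAST k. k \<in> ?l ` B)"
  have p: "p \<in> ?l ` A" "\<And>u. u \<in> A \<Longrightarrow> p \<le> ?l u"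
    unfolding p_def using Cons.prems(1) by (auto intro: LeastI Least_le)
  have q: "q \<in> ?l ` B" "\<And>u. u \<in> B \<Longrightarrow> q \<le> ?l u"
    unfolding q_def using Cons.prems(2) by (auto intro: LeastI Least_le)
  from p(1) q(1) have "{u\<in>A. ?l u = p} \<noteq> {}" "{v\<in>B. ?l v = q} \<noteq> {}"
    by auto
  from Cons.IH[OF this] obtain a b where ab: "a \<in> A" "?l a = p" "b \<in> B" "?l b = q"
    and *: "\<And>u v. \<lbrakk>u \<in> A; ?l u = p; v \<in> B; ?l v = q; u + v = a + b\<rbrakk> \<Longrightarrow>
           \<forall>i\<in>set xs. Poly_Mapping.lookup u i = Poly_Mapping.lookup a i"
    by blast
  have "\<forall>i\<in>set (x # xs). Poly_Mapping.lookup u i = Poly_Mapping.lookup a i"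
    if uv: "u \<in> A" "v \<in> B" "u + v = a + b" for u v
  proof -
    have "?l u + ?l v = p + q"
      using ab uv(3) by (metis lookup_add)
    with p(2)[OF uv(1)] q(2)[OF uv(2)] have "?l u = p" "?l v = q"
      by linarith+
    with *[of u v] uv ab show ?thesis by auto
  qed
  with ab show ?case by blast
qed

instance mfps :: (idom, finite) idom
proof
  fix f g :: "('a, 'b) mfps"
  assume "f \<noteq> 0" "g \<noteq> 0"
  let ?A = "{m. mfps_nth f m \<noteq> 0}" and ?B = "{m. mfps_nth g m \<noteq> 0}"
  have "?A \<noteq> {}" "?B \<noteq> {}"
    using \<open>f \<noteq> 0\<close> \<open>g \<noteq> 0\<close> by (auto intro: mfps_eqI simp: zero_mfps.rep_eq)
  moreover obtain xs :: "'b list" where xs: "set xs = UNIV"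
    using finite_list[OF finite_class.finite_UNIV] by blast
  ultimately obtain a b where ab: "a \<in> ?A" "b \<in> ?B"
    and *: "\<And>u v. \<lbrakk>u \<in> ?A; v \<in> ?B; u + v = a + b\<rbrakk> \<Longrightarrow>
           \<forall>i\<in>set xs. Poly_Mapping.lookup u i = Poly_Mapping.lookup a i"
    using exponent_corner[of ?A ?B xs] by blast
  have corner: "u = a \<and> v = b" if "u \<in> ?A" "v \<in> ?B" "u + v = a + b" for u v
  proof -
    have "u = a"
      by (rule poly_mapping_eqI) (use *[OF that] xs in auto)
    with that(3) show ?thesis by simp
  qed
  have "mfps_nth (f * g) (a + b)
      = (\<Sum>s\<in>{(u, v). u + v = a + b}. if s = (a, b) then mfps_nth f a * mfps_nth g b else 0)"
    unfolding times_mfps.rep_eq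
    by (rule sum.cong) (use corner in auto)
  also have "\<dots> = mfps_nth f a * mfps_nth g b"
    by (simp add: finite_exponent_splits)
  also have "\<dots> \<noteq> 0"
    using ab by simp
  finally show "f * g \<noteq> 0"
    by (auto simp: zero_mfps.rep_eq)
qed

definition mfps_const :: "'a::zero \<Rightarrow> ('a, 'n) mfps" where
  "mfps_const c = Abs_mfps (\<lambda>m. if m = 0 then c else 0)"

definition mfps_var :: "'n \<Rightarrow> ('a::zero_neq_one, 'n) mfps" where
  "mfps_var i = Abs_mfps (\<lambda>m. if m = Poly_Mapping.single i 1 then 1 else 0)"


subsection \<open>The polynomial ring \<open>k[t, y]\<close>\<close>

text \<open>
  A polynomial in \<open>k[t]\<close> is a finitely supported map from exponent vectors to coefficients, and
  \<open>k[t, y]\<close> is represented as \<open>k[t][y]\<close>; the degree in \<open>y\<close> is thus \<^const>\<open>Polynomial.degree\<close>.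
\<close>

type_synonym ('a, 'n) ty_poly = "(('n \<Rightarrow>\<^sub>0 nat) \<Rightarrow>\<^sub>0 'a) poly"

definition mfps_of_mpoly :: "(('n \<Rightarrow>\<^sub>0 nat) \<Rightarrow>\<^sub>0 'a::zero) \<Rightarrow> ('a, 'n) mfps" where
  "mfps_of_mpoly q = Abs_mfps (Poly_Mapping.lookup q)"

definition eval_y :: "('a::comm_ring_1, 'n::finite) ty_poly \<Rightarrow> ('a, 'n) mfps \<Rightarrow> ('a, 'n) mfps" where
  "eval_y A f = poly (map_poly mfps_of_mpoly A) f"

definition t_exponents :: "('a::zero, 'n) ty_poly \<Rightarrow> ('n \<Rightarrow>\<^sub>0 nat) set" where
  "t_exponents A = (\<Union>j. Poly_Mapping.keys (coeff A j))"

text \<open>The element \<open>0\<close> is inserted only to give the zero polynomial degree \<open>0\<close>.\<close>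

definition deg_t :: "('a::zero, 'n::finite) ty_poly \<Rightarrow> nat" where
  "deg_t A = Max (insert 0 ((\<lambda>m. \<Sum>i\<in>UNIV. Poly_Mapping.lookup m i) ` t_exponents A))"

definition deg_t_var :: "'n \<Rightarrow> ('a::zero, 'n) ty_poly \<Rightarrow> nat" where
  "deg_t_var i A = Max (insert 0 ((\<lambda>m. Poly_Mapping.lookup m i) ` t_exponents A))"

lemma finite_t_exponents: "finite (t_exponents A)"
proof -
  have "t_exponents A \<subseteq> (\<Union>j\<le>Polynomial.degree A. Poly_Mapping.keys (coeff A j))"
    unfolding t_exponents_def
    by (auto simp del: lookup_not_eq_zero_eq_in_keys)
       (metis atMost_iff coeff_eq_0 keys_zero empty_iff not_le)
  then show ?thesis
    by (rule finite_subset) auto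
qed


subsection \<open>The field \<open>K\<close> and its section operators\<close>

type_synonym ('a, 'n) mfls = "('a, 'n) mfps fract"

definition to_K :: "('a::idom, 'n::finite) mfps \<Rightarrow> ('a, 'n) mfls" where
  "to_K f = Fract f 1"

definition scale_K :: "'a::field \<Rightarrow> ('a, 'n::finite) mfls \<Rightarrow> ('a, 'n) mfls" where
  "scale_K c x = to_K (mfps_const c) * x"

definition t_power :: "('n::finite \<Rightarrow>\<^sub>0 nat) \<Rightarrow> ('a::field, 'n) mfls" where
  "t_power r = (\<Prod>i\<in>UNIV. to_K (mfps_var i) ^ Poly_Mapping.lookup r i)"

definition perfect_field :: "'a::field itself \<Rightarrow> bool" where
  "perfect_field _ \<longleftrightarrow> CHAR('a) = 0 \<or> surj (\<lambda>x :: 'a. x ^ CHAR('a))"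

text \<open>Everything below is meant for \<open>CHAR('a) > 0\<close>, the characteristic \<open>p\<close> of \<open>K\<close>.\<close>

definition frobenius :: "('a::field, 'n::finite) mfls \<Rightarrow> ('a, 'n) mfls" where
  "frobenius x = x ^ CHAR('a)"

definition section_indices :: "'a::field itself \<Rightarrow> ('n::finite \<Rightarrow>\<^sub>0 nat) set" where
  "section_indices _ = {r. \<forall>i. Poly_Mapping.lookup r i < CHAR('a)}"

text \<open>
  The family \<open>(g\<^sub>r)\<close> of coordinates of \<open>g\<close> in the basis \<open>t\<^sup>r\<close> of \<open>K\<close> over the image of the
  Frobenius map; it exists and is unique if the coefficient field is perfect of characteristic
  \<open>p > 0\<close>. It is extended by \<open>0\<close> outside the index set to make the family unique as a
  total function.
\<close>

definition frobenius_coords ::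
    "('a::field, 'n::finite) mfls \<Rightarrow> ('n \<Rightarrow>\<^sub>0 nat) \<Rightarrow> ('a, 'n) mfls" where
  "frobenius_coords g = (THE c.
     (\<forall>r \<in> section_indices TYPE('a). c r \<in> range frobenius) \<and>
     (\<forall>r. r \<notin> section_indices TYPE('a) \<longrightarrow> c r = 0) \<and>
     g = (\<Sum>r \<in> section_indices TYPE('a). t_power r * c r))"

definition section_op ::
    "('n::finite \<Rightarrow>\<^sub>0 nat) \<Rightarrow> ('a::field, 'n) mfls \<Rightarrow> ('a, 'n) mfls" where
  "section_op r g = inv frobenius (frobenius_coords g r)"

inductive_set section_monoid :: "(('a::field, 'n::finite) mfls \<Rightarrow> ('a, 'n) mfls) set" where
  id: "id \<in> section_monoid"
| generator: "r \<in> section_indices TYPE('a) \<Longrightarrow> section_op r \<in> section_monoid"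
| comp: "\<lbrakk>F \<in> section_monoid; G \<in> section_monoid\<rbrakk> \<Longrightarrow> F \<circ> G \<in> section_monoid"

lemma mfps_const_add: "mfps_const (a + b) = mfps_const a + (mfps_const b :: ('a::comm_ring_1, 'n::finite) mfps)"
  by (rule mfps_eqI) (simp add: mfps_const_def plus_mfps.rep_eq Abs_mfps_inverse)

lemma mfps_const_1: "mfps_const 1 = (1 :: ('a::comm_ring_1, 'n::finite) mfps)"
  by (rule mfps_eqI) (simp add: mfps_const_def one_mfps.rep_eq Abs_mfps_inverse)

lemma mfps_const_mult: "mfps_const (a * b) = mfps_const a * (mfps_const b :: ('a::comm_ring_1, 'n::finite) mfps)"
proof (rule mfps_eqI)
  fix m :: "'n \<Rightarrow>\<^sub>0 nat"
  have "mfps_nth (mfps_const a * (mfps_const b :: ('a, 'n) mfps)) m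
      = (\<Sum>s\<in>{(u, v). u + v = m}. if s = (0, 0) then a * b else 0)"
    unfolding times_mfps.rep_eq
    by (rule sum.cong) (auto simp: mfps_const_def Abs_mfps_inverse split: if_splits)
  also have "\<dots> = mfps_nth (mfps_const (a * b)) m"
    by (auto simp: finite_exponent_splits mfps_const_def Abs_mfps_inverse)
  finally show "mfps_nth (mfps_const (a * b)) m
      = mfps_nth (mfps_const a * (mfps_const b :: ('a, 'n) mfps)) m" ..
qed

lemma to_K_add: "to_K (f + g) = to_K f + to_K g"
  by (simp add: to_K_def)

lemma to_K_mult: "to_K (f * g) = to_K f * to_K g"
  by (simp add: to_K_def)

lemma to_K_1: "to_K 1 = 1"
  by (simp add: to_K_def One_fract_def)

interpretation K: vector_space "scale_K :: 'a::field \<Rightarrow> ('a, 'n::finite) mfls \<Rightarrow> _"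
  by unfold_locales
     (simp_all add: scale_K_def mfps_const_add mfps_const_mult mfps_const_1
        to_K_add to_K_mult to_K_1 algebra_simps)

end

theory Submission
  imports Defs "HOL-Computational_Algebra.Primes"
begin

text \<open>
  Let \<open>B\<close> be an annihilator of \<open>f\<close> that satisfies the degree bounds and has \<open>B\<^sub>y(f) \<noteq> 0\<close>. The
  space \<open>W\<close> consists of the quotients \<open>P(f) / B\<^sub>y(f)\<close>, the residues of \<open>P / B\<close> at \<open>y = f\<close>, where
  \<open>P\<close> ranges over the polynomials satisfying the same degree bounds. Since
  \<open>P / B = P B\<^bsup>p-1\<^esup> / B\<^sup>p\<close>, a section of the residue of \<open>P / B\<close> is the residue of \<open>Q / B\<close>, where
  \<open>Q\<close> is a section of \<open>P B\<^bsup>p-1\<^esup>\<close> in the variables \<open>t, y\<close>; taking sections divides the degrees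
  by \<open>p\<close>, so \<open>Q\<close> satisfies the degree bounds again. The choice \<open>P = y B\<^sub>y\<close> gives \<open>f \<in> W\<close>.
\<close>

subsection \<open>Exponent vectors\<close>

lift_definition exp_scale :: "nat \<Rightarrow> ('n \<Rightarrow>\<^sub>0 nat) \<Rightarrow> ('n \<Rightarrow>\<^sub>0 nat)" is "\<lambda>k e i. k * e i"
  by (erule finite_subset[rotated]) auto

lemma lookup_exp_scale [simp]: "Poly_Mapping.lookup (exp_scale k e) i = k * Poly_Mapping.lookup e i"
  by transfer simp

lemma exp_scale_0 [simp]: "exp_scale 0 e = 0"
  by (rule poly_mapping_eqI) simp

lemma exp_scale_Suc: "exp_scale (Suc k) e = e + exp_scale k e"
  by (rule poly_mapping_eqI) (simp add: lookup_add)

lemma exp_scale_div_mod: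
  fixes m :: "'n::finite \<Rightarrow>\<^sub>0 nat"
  assumes "p > 0"
  obtains e r where "m = exp_scale p e + r" "\<And>i. Poly_Mapping.lookup r i < p"
proof
  let ?e = "Abs_poly_mapping (\<lambda>i. Poly_Mapping.lookup m i div p)"
  let ?r = "Abs_poly_mapping (\<lambda>i. Poly_Mapping.lookup m i mod p)"
  show "m = exp_scale p ?e + ?r"
    by (rule poly_mapping_eqI) (simp add: lookup_add)
  show "Poly_Mapping.lookup ?r i < p" for i
    using assms by simp
qed

lemma exp_scale_add_inject:
  assumes "\<And>i. Poly_Mapping.lookup r i < p" "\<And>i. Poly_Mapping.lookup r' i < p"
    and "exp_scale p e + r = exp_scale p e' + r'"
  shows "e = e' \<and> r = r'"
proof -
  have *: "p * Poly_Mapping.lookup e i + Poly_Mapping.lookup r i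
      = p * Poly_Mapping.lookup e' i + Poly_Mapping.lookup r' i" for i
    using arg_cong[OF assms(3), of "\<lambda>m. Poly_Mapping.lookup m i"] by (simp add: lookup_add)
  have "Poly_Mapping.lookup e i = Poly_Mapping.lookup e' i
      \<and> Poly_Mapping.lookup r i = Poly_Mapping.lookup r' i" for i
    using arg_cong[OF *[of i], of "\<lambda>m. m div p"] arg_cong[OF *[of i], of "\<lambda>m. m mod p"]
      assms(1)[of i] assms(2)[of i] by simp
  then show ?thesis
    by (auto intro: poly_mapping_eqI)
qed

definition weight :: "'n set \<Rightarrow> ('n \<Rightarrow>\<^sub>0 nat) \<Rightarrow> nat" where
  "weight T m = (\<Sum>i\<in>T. Poly_Mapping.lookup m i)"

lemma weight_add: "weight T (a + b) = weight T a + weight T b"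
  by (simp add: weight_def lookup_add sum.distrib)

lemma weight_exp_scale: "weight T (exp_scale k e) = k * weight T e"
  by (simp add: weight_def sum_distrib_left)

lemma weight_0 [simp]: "weight T 0 = 0"
  by (simp add: weight_def)

lemma exponents_box:
  fixes b :: "'n::finite \<Rightarrow> nat"
  defines "I \<equiv> {e :: 'n \<Rightarrow>\<^sub>0 nat. \<forall>i. Poly_Mapping.lookup e i \<le> b i}"
  shows "finite I \<and> card I \<le> (\<Prod>i\<in>UNIV. b i + 1)"
proof
  show "finite I"
    unfolding I_def by (rule finite_exponents_le)
  have "card I \<le> card (\<Pi>\<^sub>E i\<in>(UNIV :: 'n set). {..b i})"
    by (rule card_inj_on_le[where f = Poly_Mapping.lookup])
       (auto simp: I_def inj_on_def intro!: finite_PiE)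
  then show "card I \<le> (\<Prod>i\<in>UNIV. b i + 1)"
    by (simp add: card_PiE)
qed

lemma exponents_simplex:
  fixes h :: nat
  defines "I \<equiv> {e :: 'n::finite \<Rightarrow>\<^sub>0 nat. weight UNIV e \<le> h}"
  shows "finite I \<and> card I \<le> (CARD('n) + h) choose CARD('n)"
proof
  have "Poly_Mapping.lookup e i \<le> weight UNIV e" for e :: "'n \<Rightarrow>\<^sub>0 nat" and i
    unfolding weight_def by (rule member_le_sum) auto
  then have "I \<subseteq> {e. \<forall>i. Poly_Mapping.lookup e i \<le> h}"
    unfolding I_def using order_trans by blast
  then show "finite I"
    by (rule finite_subset) (rule finite_exponents_le)
  obtain xs :: "'n list" where xs: "set xs = UNIV" "distinct xs"
    using finite_distinct_list[OF finite_class.finite_UNIV] by blast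
  have len: "length xs = CARD('n)"
    using xs distinct_card by force
  have sum: "sum_list (map (Poly_Mapping.lookup e) xs) = weight UNIV e" for e
    using xs by (simp add: weight_def sum_list_distinct_conv_sum_set)
  let ?L = "{l :: nat list. length l = CARD('n) + 1 \<and> sum_list l = h}"
  have "card I \<le> card ?L"
  proof (rule card_inj_on_le[where f = "\<lambda>e. (h - weight UNIV e) # map (Poly_Mapping.lookup e) xs"])
    show "inj_on (\<lambda>e. (h - weight UNIV e) # map (Poly_Mapping.lookup e) xs) I"
      using xs(1) by (auto simp: inj_on_def intro!: poly_mapping_eqI)
    show "(\<lambda>e. (h - weight UNIV e) # map (Poly_Mapping.lookup e) xs) ` I \<subseteq> ?L"
      by (auto simp: I_def len sum)
    show "finite ?L"
    proof (rule finite_subset)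
      show "?L \<subseteq> {l. set l \<subseteq> {..h} \<and> length l = CARD('n) + 1}"
        using member_le_sum_list by fastforce
    qed (rule finite_lists_length_eq, simp)
  qed
  also have "\<dots> = (CARD('n) + h) choose CARD('n)"
    using card_length_sum_list[of "CARD('n) + 1" h] binomial_symmetric[of h "CARD('n) + h"]
    by (simp add: add.commute)
  finally show "card I \<le> (CARD('n) + h) choose CARD('n)" .
qed


subsection \<open>Monomials and Frobenius on power series\<close>

definition mfps_monom :: "'a::zero \<Rightarrow> ('n \<Rightarrow>\<^sub>0 nat) \<Rightarrow> ('a, 'n) mfps" where
  "mfps_monom c e = Abs_mfps (\<lambda>m. if m = e then c else 0)"

lemma nth_mfps_monom: "mfps_nth (mfps_monom c e) m = (if m = e then c else 0)"
  by (simp add: mfps_monom_def Abs_mfps_inverse)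

lemma mfps_const_eq_monom: "mfps_const c = mfps_monom c 0"
  by (simp add: mfps_const_def mfps_monom_def)

lemma nth_sum: "mfps_nth (\<Sum>x\<in>X. g x) m = (\<Sum>x\<in>X. mfps_nth (g x :: ('a::comm_ring_1, 'n::finite) mfps) m)"
  by (induction X rule: infinite_finite_induct) (auto simp: zero_mfps.rep_eq plus_mfps.rep_eq)

lemma nth_monom_mult:
  fixes g :: "('a::comm_ring_1, 'n::finite) mfps"
  shows "mfps_nth (mfps_monom c r * g) (r + e) = c * mfps_nth g e"
proof -
  have "mfps_nth (mfps_monom c r * g) (r + e)
      = (\<Sum>s\<in>{(u, v). u + v = r + e}. if s = (r, e) then c * mfps_nth g e else 0)"
    unfolding times_mfps.rep_eq by (rule sum.cong) (auto simp: nth_mfps_monom split: if_splits)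
  also have "\<dots> = c * mfps_nth g e"
    by (simp add: finite_exponent_splits)
  finally show ?thesis .
qed

lemma nth_mult_nonzeroE:
  fixes g h :: "('a::comm_ring_1, 'n::finite) mfps"
  assumes "mfps_nth (g * h) m \<noteq> 0"
  obtains u v where "m = u + v" "mfps_nth g u \<noteq> 0" "mfps_nth h v \<noteq> 0"
proof -
  have "\<exists>s\<in>{(u, v). u + v = m}. (case s of (u, v) \<Rightarrow> mfps_nth g u * mfps_nth h v) \<noteq> 0"
    using assms unfolding times_mfps.rep_eq by (metis (no_types, lifting) sum.neutral)
  then obtain u v where "u + v = m" "mfps_nth g u * mfps_nth h v \<noteq> 0"
    by auto
  then show thesis
    by (intro that[of u v]) auto
qed

lemma nth_mfps_const_mult:
  "mfps_nth (mfps_const c * (g :: ('a::comm_ring_1, 'n::finite) mfps)) m = c * mfps_nth g m"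
  using nth_monom_mult[of c 0 g m] by (simp add: mfps_const_eq_monom)

lemma mfps_monom_mult:
  "mfps_monom c e * mfps_monom c' e' = (mfps_monom (c * c') (e + e') :: ('a::comm_ring_1, 'n::finite) mfps)"
proof (rule mfps_eqI)
  fix m
  show "mfps_nth (mfps_monom c e * mfps_monom c' e' :: ('a, 'n) mfps) m
      = mfps_nth (mfps_monom (c * c') (e + e')) m"
  proof (cases "\<exists>m'. m = e + m'")
    case True
    then show ?thesis by (auto simp: nth_monom_mult nth_mfps_monom)
  next
    case False
    then have "mfps_nth (mfps_monom c e * mfps_monom c' e' :: ('a, 'n) mfps) m = 0"
      by (metis (full_types) nth_mfps_monom nth_mult_nonzeroE)
    with False show ?thesis by (auto simp: nth_mfps_monom)
  qed
qed

lemma mfps_monom_1_0: "mfps_monom 1 0 = (1 :: ('a::comm_ring_1, 'n::finite) mfps)"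
  by (simp add: mfps_const_1 flip: mfps_const_eq_monom)

lemma mfps_monom_power:
  "mfps_monom c e ^ k = (mfps_monom (c ^ k) (exp_scale k e) :: ('a::comm_ring_1, 'n::finite) mfps)"
  by (induction k) (simp_all add: mfps_monom_1_0 mfps_monom_mult exp_scale_Suc)

lemma of_nat_mfps: "of_nat k = (mfps_const (of_nat k) :: ('a::comm_ring_1, 'n::finite) mfps)"
proof (induction k)
  case 0
  show ?case by (rule mfps_eqI) (simp add: mfps_const_eq_monom nth_mfps_monom zero_mfps.rep_eq)
qed (simp add: mfps_const_add mfps_const_1)

lemma CHAR_mfps [simp]: "CHAR(('a::comm_ring_1, 'n::finite) mfps) = CHAR('a)"
proof (rule CHAR_eqI)
  have const: "mfps_const (c :: 'a) = (0 :: ('a, 'n) mfps) \<longleftrightarrow> c = 0" for c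
  proof
    assume "mfps_const c = (0 :: ('a, 'n) mfps)"
    then have "mfps_nth (mfps_const c :: ('a, 'n) mfps) 0 = 0"
      by (simp add: zero_mfps.rep_eq)
    then show "c = 0"
      by (simp add: mfps_const_eq_monom nth_mfps_monom)
  qed (rule mfps_eqI, simp add: mfps_const_eq_monom nth_mfps_monom zero_mfps.rep_eq)
  show "of_nat CHAR('a) = (0 :: ('a, 'n) mfps)"
    by (simp add: of_nat_mfps const)
  show "CHAR('a) dvd k" if "of_nat k = (0 :: ('a, 'n) mfps)" for k
    using that by (simp add: of_nat_mfps const of_nat_eq_0_iff_char_dvd)
qed

lemma CHAR_fract [simp]: "CHAR('a::idom fract) = CHAR('a)"
  by (rule CHAR_eqI) (auto simp: of_nat_fract Zero_fract_def eq_fract of_nat_eq_0_iff_char_dvd)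

lemma nth_frobenius:
  fixes u :: "('a::comm_ring_1, 'n::finite) mfps"
  assumes prime: "prime CHAR('a)"
  defines "p \<equiv> CHAR('a)"
  shows "mfps_nth (u ^ p) (exp_scale p e) = mfps_nth u e ^ p"
    and "mfps_nth (u ^ p) m \<noteq> 0 \<Longrightarrow> \<exists>e. m = exp_scale p e"
proof -
  have p: "p > 0"
    unfolding p_def using prime prime_gt_0_nat by blast
  have main: "mfps_nth (u ^ p) m = (\<Sum>e\<in>{e. \<forall>i. Poly_Mapping.lookup e i \<le> Poly_Mapping.lookup m i}.
      if m = exp_scale p e then mfps_nth u e ^ p else 0)" for m
  proof -
    define U where "U = {e :: 'n \<Rightarrow>\<^sub>0 nat. \<forall>i. Poly_Mapping.lookup e i \<le> Poly_Mapping.lookup m i}"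
    have fin: "finite U"
      unfolding U_def by (rule finite_exponents_le)
    define v where "v = (\<Sum>e\<in>U. mfps_monom (mfps_nth u e) e)"
    define w where "w = u - v"
    have w: "mfps_nth w e = 0" if "e \<in> U" for e
      using that fin by (simp add: w_def v_def minus_mfps.rep_eq nth_sum nth_mfps_monom)
    have "mfps_nth (w ^ p) m = 0"
    proof (rule ccontr)
      assume "mfps_nth (w ^ p) m \<noteq> 0"
      moreover have "w ^ p = w * w ^ (p - 1)"
        using power_minus_mult[OF p, of w] by (simp add: mult.commute)
      ultimately obtain a b where "m = a + b" "mfps_nth w a \<noteq> 0"
        by (metis nth_mult_nonzeroE)
      then show False
        using w[of a] by (auto simp: U_def lookup_add)
    qed
    moreover have "u ^ p = v ^ p + w ^ p"
      using freshmans_dream[of p v w] prime by (simp add: w_def p_def)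
    moreover have "v ^ p = (\<Sum>e\<in>U. mfps_monom (mfps_nth u e ^ p) (exp_scale p e))"
      unfolding v_def using prime
      by (subst freshmans_dream_sum) (simp_all add: p_def mfps_monom_power)
    ultimately show ?thesis
      by (simp add: plus_mfps.rep_eq nth_sum nth_mfps_monom U_def)
  qed
  have inj: "exp_scale p e = exp_scale p e' \<longleftrightarrow> e = e'" for e e' :: "'n \<Rightarrow>\<^sub>0 nat"
    using exp_scale_add_inject[of 0 p 0 e e'] p by auto
  have "e \<in> {e'. \<forall>i. Poly_Mapping.lookup e' i \<le> Poly_Mapping.lookup (exp_scale p e) i}"
    using p by auto
  then show "mfps_nth (u ^ p) (exp_scale p e) = mfps_nth u e ^ p"
    by (subst main) (simp add: inj finite_exponents_le)
  show "\<exists>e. m = exp_scale p e" if "mfps_nth (u ^ p) m \<noteq> 0"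
  proof (rule ccontr)
    assume "\<nexists>e. m = exp_scale p e"
    then have "mfps_nth (u ^ p) m = 0"
      unfolding main by (intro sum.neutral) auto
    with that show False ..
  qed
qed

lemma finite_section_indices: "CHAR('a) > 0 \<Longrightarrow> finite (section_indices TYPE('a::field) :: ('n::finite \<Rightarrow>\<^sub>0 nat) set)"
  by (rule finite_subset[OF _ finite_exponents_le[of "\<lambda>_. CHAR('a)"]])
     (auto simp: section_indices_def less_imp_le)

lemma nth_frobenius_sum:
  fixes u :: "('n::finite \<Rightarrow>\<^sub>0 nat) \<Rightarrow> ('a::field, 'n) mfps"
  assumes prime: "prime CHAR('a)" and r: "r \<in> section_indices TYPE('a)"
  shows "mfps_nth (\<Sum>r\<in>section_indices TYPE('a). mfps_monom 1 r * u r ^ CHAR('a)) (exp_scale CHAR('a) e + r)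
      = mfps_nth (u r) e ^ CHAR('a)"
proof -
  let ?p = "CHAR('a)" and ?R = "section_indices TYPE('a) :: ('n \<Rightarrow>\<^sub>0 nat) set"
  have "mfps_nth (mfps_monom 1 r' * u r' ^ ?p) (exp_scale ?p e + r)
      = (if r' = r then mfps_nth (u r) e ^ ?p else 0)" if r': "r' \<in> ?R" for r'
  proof (cases "r' = r")
    case True
    then show ?thesis
      using nth_monom_mult[of 1 r "u r ^ ?p" "exp_scale ?p e"]
      by (simp add: add.commute nth_frobenius(1)[OF prime])
  next
    case False
    have "mfps_nth (mfps_monom 1 r' * u r' ^ ?p) (exp_scale ?p e + r) = 0"
    proof (rule ccontr)
      assume "mfps_nth (mfps_monom 1 r' * u r' ^ ?p) (exp_scale ?p e + r) \<noteq> 0"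
      then obtain a b where ab: "exp_scale ?p e + r = a + b" "mfps_nth (mfps_monom 1 r' :: ('a, 'n) mfps) a \<noteq> 0"
          "mfps_nth (u r' ^ ?p) b \<noteq> 0"
        by (rule nth_mult_nonzeroE)
      from nth_frobenius(2)[OF prime ab(3)] obtain e' where "b = exp_scale ?p e'" ..
      with ab have "exp_scale ?p e + r = exp_scale ?p e' + r'"
        by (auto simp: nth_mfps_monom add.commute split: if_splits)
      with r r' False show False
        using exp_scale_add_inject[of r ?p r' e e'] by (auto simp: section_indices_def)
    qed
    with False show ?thesis by simp
  qed
  then show ?thesis
    using r finite_section_indices[where ?'a = 'a and ?'n = 'n] prime
    by (simp add: nth_sum prime_gt_0_nat)
qed


definition frob_root :: "'a::field \<Rightarrow> 'a" where
  "frob_root x = (SOME y. y ^ CHAR('a) = x)"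

lemma frob_root_power:
  assumes "perfect_field TYPE('a::field)" "CHAR('a) > 0"
  shows "frob_root x ^ CHAR('a) = (x :: 'a)"
proof -
  have "\<exists>y :: 'a. y ^ CHAR('a) = x"
    using assms by (metis perfect_field_def less_irrefl surjD)
  then show ?thesis
    unfolding frob_root_def by (rule someI_ex)
qed

definition mfps_section :: "('n \<Rightarrow>\<^sub>0 nat) \<Rightarrow> ('a::field, 'n) mfps \<Rightarrow> ('a, 'n) mfps" where
  "mfps_section r g = Abs_mfps (\<lambda>e. frob_root (mfps_nth g (exp_scale CHAR('a) e + r)))"

lemma nth_mfps_section:
  "mfps_nth (mfps_section r (g :: ('a::field, 'n) mfps)) e
    = frob_root (mfps_nth g (exp_scale CHAR('a) e + r))"
  by (simp add: mfps_section_def Abs_mfps_inverse)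

lemma nth_mfps_section_nonzeroD:
  assumes "perfect_field TYPE('a::field)" "CHAR('a) > 0"
    and "mfps_nth (mfps_section r (g :: ('a, 'n) mfps)) e \<noteq> 0"
  shows "mfps_nth g (exp_scale CHAR('a) e + r) \<noteq> 0"
  using assms frob_root_power[OF assms(1,2), of 0] by (auto simp: nth_mfps_section)

lemma mfps_section_0:
  assumes "perfect_field TYPE('a::field)" "CHAR('a) > 0"
  shows "mfps_section r (0 :: ('a, 'n::finite) mfps) = 0"
  using nth_mfps_section_nonzeroD[OF assms, of r "0 :: ('a, 'n) mfps"]
  by (intro mfps_eqI) (auto simp: zero_mfps.rep_eq)

lemma mfps_section_expansion:
  fixes g :: "('a::field, 'n::finite) mfps"
  assumes perf: "perfect_field TYPE('a)" and prime: "prime CHAR('a)"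
  shows "g = (\<Sum>r\<in>section_indices TYPE('a). mfps_monom 1 r * mfps_section r g ^ CHAR('a))"
proof (rule mfps_eqI)
  fix m :: "'n \<Rightarrow>\<^sub>0 nat"
  have p: "CHAR('a) > 0"
    using prime prime_gt_0_nat by blast
  obtain e r where m: "m = exp_scale CHAR('a) e + r" "\<And>i. Poly_Mapping.lookup r i < CHAR('a)"
    using exp_scale_div_mod[OF p] by blast
  then have "r \<in> section_indices TYPE('a)"
    by (simp add: section_indices_def)
  then show "mfps_nth g m
      = mfps_nth (\<Sum>r\<in>section_indices TYPE('a). mfps_monom 1 r * mfps_section r g ^ CHAR('a)) m"
    unfolding m(1) by (subst nth_frobenius_sum[OF prime])
      (simp_all add: nth_mfps_section frob_root_power[OF perf p])
qed

lemma mfps_frobenius_independent: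
  fixes u :: "('n::finite \<Rightarrow>\<^sub>0 nat) \<Rightarrow> ('a::field, 'n) mfps"
  assumes prime: "prime CHAR('a)"
    and zero: "(\<Sum>r\<in>section_indices TYPE('a). mfps_monom 1 r * u r ^ CHAR('a)) = 0"
    and r: "r \<in> section_indices TYPE('a)"
  shows "u r = 0"
proof (rule mfps_eqI)
  fix e
  have "mfps_nth (u r) e ^ CHAR('a) = 0"
    using nth_frobenius_sum[OF prime r, of u e] zero by (simp add: zero_mfps.rep_eq)
  then show "mfps_nth (u r) e = mfps_nth 0 e"
    by (simp add: zero_mfps.rep_eq)
qed


subsection \<open>Sections of polynomials in \<open>y\<close>\<close>

definition contract :: "nat \<Rightarrow> nat \<Rightarrow> 'a::zero poly \<Rightarrow> 'a poly" where
  "contract p s Q = Abs_poly (\<lambda>j. coeff Q (p * j + s))"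

lemma coeff_contract:
  assumes "p > 0"
  shows "coeff (contract p s Q) j = coeff Q (p * j + s)"
proof -
  have "degree Q < p * i + s" if "i > degree Q" for i
    using that assms mult_le_mono1[of 1 p i] by linarith
  then show ?thesis
    unfolding contract_def by (subst coeff_Abs_poly[where n = "degree Q"]) (auto intro: coeff_eq_0)
qed

lemma contract_add: "p > 0 \<Longrightarrow> contract p s (P + Q) = contract p s P + contract p s Q"
  by (rule poly_eqI) (simp add: coeff_contract)

lemma contract_smult: "p > 0 \<Longrightarrow> contract p s (smult c Q) = smult c (contract p s Q)"
  by (rule poly_eqI) (simp add: coeff_contract)

lemma contract_monom_mult:
  fixes Q :: "'a::comm_semiring_1 poly"
  assumes "s < p"
  shows "contract p s (monom 1 p * Q) = pCons 0 (contract p s Q)"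
proof (rule poly_eqI)
  fix j
  show "coeff (contract p s (monom 1 p * Q)) j = coeff (pCons 0 (contract p s Q)) j"
    using assms by (cases j) (simp_all add: coeff_contract coeff_monom_mult)
qed

lemma degree_contract_le:
  assumes "p > 0" "degree Q \<le> p * d"
  shows "degree (contract p s Q) \<le> d"
proof (rule degree_le, intro allI impI)
  fix i assume "d < i"
  then have "p * d < p * i + s"
    using assms by (simp add: trans_less_add1)
  with assms show "coeff (contract p s Q) i = 0"
    by (simp add: coeff_contract coeff_eq_0)
qed

text \<open>
  Modulo \<open>(y - f)\<^sup>p = y\<^sup>p - f\<^sup>p\<close>, the polynomial \<open>(y - f)\<^bsup>p-1\<^esup> Q\<close> is \<open>Q(f) (y - f)\<^bsup>p-1\<^esup>\<close>, while
  evaluating the contraction at \<open>f\<^sup>p\<close> reads off the coefficient of \<open>y\<^bsup>p-1\<^esup>\<close> modulo \<open>y\<^sup>p - f\<^sup>p\<close>.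
\<close>

lemma poly_contract_linear_power:
  fixes Q :: "'a::idom poly"
  assumes prime: "prime CHAR('a)"
  defines "p \<equiv> CHAR('a)"
  shows "poly (contract p (p - 1) ([:- f, 1:] ^ (p - 1) * Q)) (f ^ p) = poly Q f"
proof -
  have p: "p > 0" "p - 1 < p"
    unfolding p_def using prime prime_gt_0_nat by auto
  have CHAR_poly: "CHAR('a poly) = p"
    unfolding p_def by (rule CHAR_eqI) (auto simp: of_nat_poly of_nat_eq_0_iff_char_dvd)
  have "[:- f, 1:] = monom 1 1 + [:- f:]"
    by (simp add: monom_altdef)
  then have "[:- f, 1:] ^ p = monom 1 1 ^ p + [:- f:] ^ p"
    using freshmans_dream[of p "monom 1 1" "[:- f:]"] prime by (simp add: CHAR_poly p_def)
  then have lin: "[:- f, 1:] ^ p = monom 1 p + [:(- f) ^ p:]"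
    by (simp add: monom_power poly_const_pow)
  have neg: "f ^ p + (- f) ^ p = 0"
    using freshmans_dream[of p f "- f"] prime p by (simp add: p_def power_0_left)
  have "[:- f, 1:] dvd Q - [:poly Q f:]"
    by (simp flip: poly_eq_0_iff_dvd)
  then obtain Q' where "Q - [:poly Q f:] = [:- f, 1:] * Q'" ..
  then have "Q = [:poly Q f:] + [:- f, 1:] * Q'"
    by (simp add: algebra_simps)
  then have "[:- f, 1:] ^ (p - 1) * Q
      = [:- f, 1:] ^ (p - 1) * ([:poly Q f:] + [:- f, 1:] * Q')"
    by simp
  also have "\<dots> = smult (poly Q f) ([:- f, 1:] ^ (p - 1)) + [:- f, 1:] ^ p * Q'"
    by (simp only: distrib_left mult_smult_right flip: mult.assoc power_minus_mult[OF p(1)]) (simp add: mult.commute)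
  also have "\<dots> = smult (poly Q f) ([:- f, 1:] ^ (p - 1)) + (monom 1 p * Q' + smult ((- f) ^ p) Q')"
    by (simp add: lin distrib_right)
  finally have *: "[:- f, 1:] ^ (p - 1) * Q = \<dots>" .
  have "contract p (p - 1) ([:- f, 1:] ^ (p - 1)) = 1"
  proof (rule poly_eqI)
    fix j
    have "p - 1 < p * j + (p - 1)" if "j \<noteq> 0"
      using that p(1) by (simp only: less_add_same_cancel2 nat_0_less_mult_iff) simp
    then show "coeff (contract p (p - 1) ([:- f, 1:] ^ (p - 1))) j = coeff 1 j"
      using p coeff_linear_power[of "- f" "p - 1"] degree_linear_power[of "- f" "p - 1"]
      by (cases "j = 0") (simp_all only: coeff_contract coeff_eq_0, simp_all add: coeff_eq_0)
  qed
  moreover have "f ^ p * x + (- f) ^ p * x = 0" for x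
    using neg by (simp flip: distrib_right)
  ultimately show ?thesis
    unfolding * using p by (simp add: contract_add contract_smult contract_monom_mult)
qed

lemma poly_contract_of_pderiv_0:
  fixes A :: "'a::idom poly"
  assumes deriv: "pderiv A = 0"
  defines "p \<equiv> CHAR('a)"
  assumes p: "p > 0"
  shows "poly (contract p 0 A) (f ^ p) = poly A f"
    and "A \<noteq> 0 \<Longrightarrow> contract p 0 A \<noteq> 0"
proof -
  have zero: "coeff A i = 0" if ndvd: "\<not> p dvd i" for i
  proof -
    obtain k where k: "i = Suc k"
      using ndvd by (cases i) auto
    have "of_nat i * coeff A i = 0"
      using coeff_pderiv[of A k, symmetric] by (simp only: deriv k coeff_0)
    moreover have "of_nat i \<noteq> (0 :: 'a)"
      using ndvd by (simp only: of_nat_eq_0_iff_char_dvd p_def not_False_eq_True)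
    ultimately show ?thesis
      by simp
  qed
  let ?N = "degree A"
  have "poly A f = (\<Sum>i\<le>p * ?N. coeff A i * f ^ i)"
    unfolding poly_altdef
  proof (rule sum.mono_neutral_left)
    show "{..?N} \<subseteq> {..p * ?N}"
      using p mult_le_mono1[of 1 p ?N] by auto
  qed (auto simp: coeff_eq_0)
  also have "\<dots> = (\<Sum>i\<in>(*) p ` {..?N}. coeff A i * f ^ i)"
  proof (rule sum.mono_neutral_right)
    show "\<forall>i\<in>{..p * ?N} - (*) p ` {..?N}. coeff A i * f ^ i = 0"
    proof
      fix i assume "i \<in> {..p * ?N} - (*) p ` {..?N}"
      with p have "\<not> p dvd i"
        by (auto elim!: dvdE)
      then show "coeff A i * f ^ i = 0"
        by (simp add: zero)
    qed
  qed auto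
  also have "\<dots> = (\<Sum>j\<le>?N. coeff (contract p 0 A) j * (f ^ p) ^ j)"
    using p by (subst sum.reindex) (auto simp: inj_on_def coeff_contract power_mult)
  also have "\<dots> = poly (contract p 0 A) (f ^ p)"
    unfolding poly_altdef using p degree_contract_le[OF p, of A ?N 0]
    by (intro sum.mono_neutral_right) (auto simp: coeff_eq_0)
  finally show "poly (contract p 0 A) (f ^ p) = poly A f" ..
  show "contract p 0 A \<noteq> 0" if "A \<noteq> 0"
  proof
    assume contr: "contract p 0 A = 0"
    from that have "coeff A ?N \<noteq> 0"
      by simp
    then obtain j where "?N = p * j"
      using zero by blast
    then have "coeff (contract p 0 A) j = lead_coeff A"
      using p by (simp add: coeff_contract)
    with that contr show False
      by simp
  qed
qed

lemma poly_power_section_expansion: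
  fixes C :: "('a::field, 'n::finite) mfps poly"
  assumes perf: "perfect_field TYPE('a)" and prime: "prime CHAR('a)"
  shows "poly C (f ^ CHAR('a))
      = (\<Sum>r\<in>section_indices TYPE('a). mfps_monom 1 r * poly (map_poly (mfps_section r) C) f ^ CHAR('a))"
proof (induction C)
  case 0
  show ?case
    using prime by (simp add: power_0_left)
next
  case (pCons c C)
  let ?p = "CHAR('a)" and ?R = "section_indices TYPE('a) :: ('n \<Rightarrow>\<^sub>0 nat) set"
  have p: "?p > 0"
    using prime prime_gt_0_nat by blast
  have frob: "(x + y) ^ ?p = x ^ ?p + y ^ ?p" for x y :: "('a, 'n) mfps"
    using prime by (intro freshmans_dream) simp_all
  have "poly (pCons c C) (f ^ ?p) = c + f ^ ?p * poly C (f ^ ?p)"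
    by simp
  also have "\<dots> = (\<Sum>r\<in>?R. mfps_monom 1 r * mfps_section r c ^ ?p)
      + f ^ ?p * (\<Sum>r\<in>?R. mfps_monom 1 r * poly (map_poly (mfps_section r) C) f ^ ?p)"
    using mfps_section_expansion[OF perf prime, of c] pCons.IH by (metis (no_types, lifting))
  also have "\<dots> = (\<Sum>r\<in>?R. mfps_monom 1 r * poly (map_poly (mfps_section r) (pCons c C)) f ^ ?p)"
    by (simp add: map_poly_pCons mfps_section_0[OF perf p] frob power_mult_distrib sum_distrib_left
        distrib_left sum.distrib mult.left_commute)
  finally show ?case .
qed


abbreviation weight_le :: "'n::finite set \<Rightarrow> nat \<Rightarrow> ('a::comm_ring_1, 'n) mfps poly \<Rightarrow> bool" where
  "weight_le T b P \<equiv> \<forall>j m. mfps_nth (coeff P j) m \<noteq> 0 \<longrightarrow> weight T m \<le> b"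

text \<open>
  Bounds on the degree in single variables correspond to the pairs \<open>({i}, h\<^sub>i)\<close> in \<open>C\<close>, a bound on
  the total degree to \<open>(UNIV, h)\<close>.
\<close>

definition bounded_polys ::
    "('n::finite set \<times> nat) set \<Rightarrow> nat \<Rightarrow> ('a::comm_ring_1, 'n) mfps poly set" where
  "bounded_polys C d = {P. degree P \<le> d \<and> (\<forall>(T, b)\<in>C. weight_le T b P)}"

lemma weight_le_mult:
  fixes P Q :: "('a::comm_ring_1, 'n::finite) mfps poly"
  assumes P: "weight_le T b P" and Q: "weight_le T c Q"
  shows "weight_le T (b + c) (P * Q)"
proof (intro allI impI)
  fix j m assume "mfps_nth (coeff (P * Q) j) m \<noteq> 0"
  then have "\<exists>i\<le>j. mfps_nth (coeff P i * coeff Q (j - i)) m \<noteq> 0"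
    unfolding coeff_mult nth_sum by (metis (no_types, lifting) atMost_iff sum.neutral)
  then obtain i where "mfps_nth (coeff P i * coeff Q (j - i)) m \<noteq> 0"
    by blast
  then obtain u v where "m = u + v" "mfps_nth (coeff P i) u \<noteq> 0" "mfps_nth (coeff Q (j - i)) v \<noteq> 0"
    by (rule nth_mult_nonzeroE)
  with P Q show "weight T m \<le> b + c"
    by (auto simp: weight_add intro: add_mono)
qed

lemma weight_le_power:
  fixes P :: "('a::comm_ring_1, 'n::finite) mfps poly"
  assumes P: "weight_le T b P"
  shows "weight_le T (k * b) (P ^ k)"
proof (induction k)
  case 0
  show ?case
    by (auto simp: coeff_1 one_mfps.rep_eq zero_mfps.rep_eq split: if_splits)
next
  case (Suc k)
  show ?case
    using weight_le_mult[OF P Suc] by simp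
qed

lemma section_in_bounded_polys:
  fixes Q :: "('a::field, 'n::finite) mfps poly"
  assumes perf: "perfect_field TYPE('a)" and p: "CHAR('a) > 0"
    and deg: "degree Q \<le> CHAR('a) * d"
    and wt: "\<And>T b. (T, b) \<in> C \<Longrightarrow> weight_le T (CHAR('a) * b) Q"
  shows "map_poly (mfps_section r) (contract CHAR('a) s Q) \<in> bounded_polys C d"
proof -
  let ?D = "map_poly (mfps_section r) (contract CHAR('a) s Q)"
  have "degree ?D \<le> d"
  proof (rule degree_le, intro allI impI)
    fix i assume "d < i"
    with degree_contract_le[OF p deg, of s] show "coeff ?D i = 0"
      by (simp add: coeff_map_poly mfps_section_0[OF perf p] coeff_eq_0)
  qed
  moreover have "weight T m \<le> b" if "(T, b) \<in> C" "mfps_nth (coeff ?D j) m \<noteq> 0" for T b j m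
  proof -
    have "mfps_nth (mfps_section r (coeff Q (CHAR('a) * j + s))) m \<noteq> 0"
      using that(2) p by (simp add: coeff_map_poly mfps_section_0[OF perf p] coeff_contract)
    then have "mfps_nth (coeff Q (CHAR('a) * j + s)) (exp_scale CHAR('a) m + r) \<noteq> 0"
      by (rule nth_mfps_section_nonzeroD[OF perf p])
    then have "CHAR('a) * weight T m + weight T r \<le> CHAR('a) * b"
      using wt[OF that(1)] by (metis weight_add weight_exp_scale)
    then have "CHAR('a) * weight T m \<le> CHAR('a) * b"
      by linarith
    with p show ?thesis
      by simp
  qed
  ultimately show ?thesis
    by (auto simp: bounded_polys_def)
qed

lemma pderiv_in_bounded_polys:
  fixes A :: "('a::idom, 'n::finite) mfps poly"
  assumes A: "A \<in> bounded_polys C d"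
  shows "pderiv A \<in> bounded_polys C d" and "pCons 0 (pderiv A) \<in> bounded_polys C d"
proof -
  have coeff: "coeff (pderiv A) j = mfps_const (of_nat (Suc j)) * coeff A (Suc j)" for j
    by (simp only: coeff_pderiv of_nat_mfps)
  have coeff': "coeff (pCons 0 (pderiv A)) j = (if j = 0 then 0 else mfps_const (of_nat j) * coeff A j)" for j
    by (cases j) (simp_all only: coeff_pCons_0 coeff_pCons_Suc coeff, simp_all)
  have zero: "coeff A j = 0" if "d < j" for j
    using A that by (simp add: bounded_polys_def coeff_eq_0)
  have wt: "weight T m \<le> b" if "(T, b) \<in> C" "mfps_nth (coeff A j) m \<noteq> 0" for T b j m
    using A that by (auto simp: bounded_polys_def)
  have "degree (pderiv A) \<le> d"
    by (intro degree_le allI impI) (simp add: coeff zero)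
  moreover have "degree (pCons 0 (pderiv A)) \<le> d"
    by (intro degree_le allI impI) (simp add: coeff' zero)
  moreover have "mfps_nth (coeff (pderiv A) j) m \<noteq> 0 \<Longrightarrow> mfps_nth (coeff A (Suc j)) m \<noteq> 0" for j m
    unfolding coeff nth_mfps_const_mult by auto
  moreover have "mfps_nth (coeff (pCons 0 (pderiv A)) j) m \<noteq> 0 \<Longrightarrow> mfps_nth (coeff A j) m \<noteq> 0" for j m
    unfolding coeff' by (auto simp: nth_mfps_const_mult zero_mfps.rep_eq split: if_splits)
  ultimately show "pderiv A \<in> bounded_polys C d" and "pCons 0 (pderiv A) \<in> bounded_polys C d"
    unfolding bounded_polys_def using wt by blast+
qed

text \<open>
  The separable annihilator is one of minimal degree in \<open>y\<close>: if its derivative vanished at \<open>f\<close>,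
  minimality would make it a polynomial in \<open>y\<^sup>p\<close>, and the sections of its contraction would be
  annihilators of smaller degree satisfying the same bounds.
\<close>

lemma separable_annihilator:
  fixes A :: "('a::field, 'n::finite) mfps poly"
  assumes perf: "perfect_field TYPE('a)" and prime: "prime CHAR('a)"
    and A: "A \<in> bounded_polys C d" "A \<noteq> 0" "poly A f = 0"
  obtains B where "B \<in> bounded_polys C d" "poly B f = 0" "poly (pderiv B) f \<noteq> 0"
proof -
  let ?p = "CHAR('a)" and ?R = "section_indices TYPE('a) :: ('n \<Rightarrow>\<^sub>0 nat) set"
  let ?ann = "\<lambda>B. B \<in> bounded_polys C d \<and> B \<noteq> 0 \<and> poly B f = 0"
  have p: "?p > 0" "?p > 1"
    using prime prime_gt_0_nat prime_gt_1_nat by blast+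
  obtain B where B: "?ann B" and min: "\<And>B'. ?ann B' \<Longrightarrow> degree B \<le> degree B'"
    using ex_has_least_nat[of ?ann A degree] A by blast
  have deg: "degree B > 0"
  proof (rule ccontr)
    assume "\<not> degree B > 0"
    then obtain c where "B = [:c:]"
      using degree_0_id by (metis gr0I)
    with B show False
      by simp
  qed
  have "poly (pderiv B) f \<noteq> 0"
  proof (cases "pderiv B = 0")
    case False
    show ?thesis
    proof
      assume zero: "poly (pderiv B) f = 0"
      have "degree (pderiv B) < degree B"
        using deg by (intro degree_lessI) (simp_all add: coeff_pderiv coeff_eq_0)
      moreover have "pderiv B \<in> bounded_polys C d"
        using B pderiv_in_bounded_polys(1) by blast
      ultimately show False
        using min[of "pderiv B"] zero False by simp
    qed
  next
    case True
    let ?D = "\<lambda>r. map_poly (mfps_section r) (contract ?p 0 B)"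
    have "(\<Sum>r\<in>?R. mfps_monom 1 r * poly (?D r) f ^ ?p) = poly (contract ?p 0 B) (f ^ ?p)"
      by (rule poly_power_section_expansion[OF perf prime, symmetric])
    also have "\<dots> = 0"
      using poly_contract_of_pderiv_0(1)[OF True] p B by simp
    finally have zero: "poly (?D r) f = 0" if "r \<in> ?R" for r
      using that by (rule mfps_frobenius_independent[OF prime])
    have "contract ?p 0 B \<noteq> 0"
      using poly_contract_of_pderiv_0(2)[OF True] p B by simp
    then obtain j where j: "coeff (contract ?p 0 B) j \<noteq> 0"
      using leading_coeff_0_iff by blast
    have "\<exists>r\<in>?R. ?D r \<noteq> 0"
    proof (rule ccontr)
      assume "\<not> (\<exists>r\<in>?R. ?D r \<noteq> 0)"
      then have "mfps_section r (coeff (contract ?p 0 B) j) = 0" if "r \<in> ?R" for r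
        using that mfps_section_0[OF perf p(1)] by (metis coeff_0 coeff_map_poly)
      then have "coeff (contract ?p 0 B) j = 0"
        by (subst mfps_section_expansion[OF perf prime]) (use p in \<open>simp add: power_0_left\<close>)
      with j show False ..
    qed
    then obtain r where r: "r \<in> ?R" "?D r \<noteq> 0"
      by blast
    have le: "b \<le> ?p * b" for b
      using p by simp
    have wt: "weight_le T (?p * b) B" if "(T, b) \<in> C" for T b
    proof (intro allI impI)
      fix j m assume "mfps_nth (coeff B j) m \<noteq> 0"
      with B that have "weight T m \<le> b"
        by (auto simp: bounded_polys_def)
      with le show "weight T m \<le> ?p * b"
        by (rule order_trans[rotated])
    qed
    have in_C: "?D r \<in> bounded_polys C d'" if "degree B \<le> ?p * d'" for d'
      by (rule section_in_bounded_polys[OF perf p(1) that wt])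
    have "degree B \<le> d"
      using B by (simp add: bounded_polys_def)
    then have D: "?D r \<in> bounded_polys C d"
      by (intro in_C order_trans[OF _ le])
    have "degree B \<le> ?p * (degree B - 1)"
    proof -
      have "degree B \<noteq> 1"
      proof
        assume "degree B = 1"
        then have "coeff (pderiv B) 0 \<noteq> 0"
          using leading_coeff_0_iff[of B] by (auto simp: coeff_pderiv)
        with True show False by simp
      qed
      with deg have "degree B \<le> 2 * (degree B - 1)"
        by linarith
      also have "\<dots> \<le> ?p * (degree B - 1)"
        using p by (intro mult_le_mono1) simp
      finally show ?thesis .
    qed
    then have "?D r \<in> bounded_polys C (degree B - 1)"
      by (rule in_C)
    then have "degree (?D r) \<le> degree B - 1"
      by (simp only: bounded_polys_def mem_Collect_eq)
    with deg have "degree (?D r) < degree B"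
      by linarith
    then show ?thesis
      using min[of "?D r"] zero[OF r(1)] r(2) D by (meson not_le)
  qed
  with B show thesis
    by (intro that[of B]) auto
qed

lemma section_expansion_of_quotient:
  fixes A P :: "('a::field, 'n::finite) mfps poly"
  assumes perf: "perfect_field TYPE('a)" and prime: "prime CHAR('a)"
    and A: "poly A f = 0"
  shows "poly P f * poly (pderiv A) f ^ (CHAR('a) - 1)
      = (\<Sum>r\<in>section_indices TYPE('a). mfps_monom 1 r * poly (map_poly (mfps_section r)
          (contract CHAR('a) (CHAR('a) - 1) (A ^ (CHAR('a) - 1) * P))) f ^ CHAR('a))"
proof -
  let ?p = "CHAR('a)"
  obtain B where B: "A = [:- f, 1:] * B"
    using A poly_eq_0_iff_dvd by (metis dvdE)
  have "poly (pderiv A) f = poly B f"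
    unfolding B pderiv_mult by (simp add: pderiv_pCons)
  then have "poly P f * poly (pderiv A) f ^ (?p - 1) = poly (B ^ (?p - 1) * P) f"
    by (simp add: mult.commute)
  also have "\<dots> = poly (contract ?p (?p - 1) ([:- f, 1:] ^ (?p - 1) * (B ^ (?p - 1) * P))) (f ^ ?p)"
    using poly_contract_linear_power[where ?'a = "('a, 'n) mfps"] prime by simp
  also have "[:- f, 1:] ^ (?p - 1) * (B ^ (?p - 1) * P) = A ^ (?p - 1) * P"
    by (simp only: B power_mult_distrib mult.assoc)
  finally show ?thesis
    by (simp only: poly_power_section_expansion[OF perf prime])
qed


subsection \<open>Section operators on the fraction field\<close>

lemma to_K_0 [simp]: "to_K 0 = 0"
  by (simp add: to_K_def Zero_fract_def)

lemma to_K_eq_iff [simp]: "to_K u = to_K v \<longleftrightarrow> u = v"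
  by (simp add: to_K_def eq_fract)

lemma to_K_eq_0_iff [simp]: "to_K u = 0 \<longleftrightarrow> u = 0"
  using to_K_eq_iff[of u 0] by (simp del: to_K_eq_iff)

lemma to_K_power: "to_K (u ^ k) = to_K u ^ k"
  by (induction k) (simp_all add: to_K_1 to_K_mult)

lemma to_K_sum: "to_K (\<Sum>x\<in>X. g x) = (\<Sum>x\<in>X. to_K (g x))"
  by (induction X rule: infinite_finite_induct) (simp_all add: to_K_add)

lemma to_K_prod: "to_K (\<Prod>x\<in>X. g x) = (\<Prod>x\<in>X. to_K (g x))"
  by (induction X rule: infinite_finite_induct) (simp_all add: to_K_1 to_K_mult)

lemma t_power_eq: "t_power r = to_K (mfps_monom 1 r :: ('a::field, 'n::finite) mfps)"
proof -
  have var: "mfps_var i = (mfps_monom 1 (Poly_Mapping.single i 1) :: ('a, 'n) mfps)" for i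
    by (simp add: mfps_var_def mfps_monom_def)
  have "(\<Prod>i\<in>X. mfps_var i ^ Poly_Mapping.lookup r i)
      = (mfps_monom 1 (\<Sum>i\<in>X. exp_scale (Poly_Mapping.lookup r i) (Poly_Mapping.single i 1)) :: ('a, 'n) mfps)"
    if "finite X" for X
    using that by (induction X) (simp_all add: mfps_monom_1_0 var mfps_monom_power mfps_monom_mult)
  moreover have "(\<Sum>i\<in>UNIV. exp_scale (Poly_Mapping.lookup r i) (Poly_Mapping.single i 1)) = r"
    by (rule poly_mapping_eqI) (simp add: lookup_sum lookup_single when_def if_distrib[of "(*) _"] cong: if_cong)
  ultimately show ?thesis
    by (simp add: t_power_def flip: to_K_power to_K_prod)
qed

lemma common_denominator:
  fixes z :: "'b \<Rightarrow> ('a::field, 'n::finite) mfls"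
  assumes "finite X"
  shows "\<exists>v u. v \<noteq> 0 \<and> (\<forall>x\<in>X. to_K v * z x = to_K (u x))"
  using assms
proof (induction X)
  case empty
  show ?case by (intro exI[of _ 1]) simp
next
  case (insert x X)
  then obtain v u where vu: "v \<noteq> 0" "\<forall>x\<in>X. to_K v * z x = to_K (u x)"
    by blast
  obtain a b where ab: "z x = Fract a b" "b \<noteq> 0"
    by (cases "z x") auto
  then have zx: "to_K b * z x = to_K a"
    by (simp add: to_K_def eq_fract mult.commute)
  let ?u = "\<lambda>y. if y = x then v * a else b * u y"
  have "to_K (b * v) * z y = to_K (?u y)" if "y \<in> insert x X" for y
  proof (cases "y = x")
    case True
    have "to_K (b * v) * z x = to_K v * (to_K b * z x)"
      by (simp add: to_K_mult mult_ac)
    with True zx show ?thesis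
      by (simp add: to_K_mult)
  next
    case False
    have "to_K (b * v) * z y = to_K b * (to_K v * z y)"
      by (simp add: to_K_mult mult_ac)
    with False vu(2) that show ?thesis
      by (simp add: to_K_mult)
  qed
  with vu(1) ab(2) show ?case
    by (intro exI[of _ "b * v"] exI[of _ ?u]) auto
qed

lemma frobenius_diff:
  assumes "prime CHAR('a::field)"
  shows "frobenius (x - y) = frobenius x - frobenius (y :: ('a, 'n::finite) mfls)"
proof -
  have "(x - y + y) ^ CHAR('a) = (x - y) ^ CHAR('a) + y ^ CHAR('a)"
    by (rule freshmans_dream) (simp_all add: assms)
  then show ?thesis
    unfolding frobenius_def diff_add_cancel by (metis add_diff_cancel_right')
qed

lemma inj_frobenius:
  assumes "prime CHAR('a::field)"
  shows "inj (frobenius :: ('a, 'n::finite) mfls \<Rightarrow> _)"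
proof (rule injI)
  fix x y :: "('a, 'n) mfls"
  assume "frobenius x = frobenius y"
  then have "frobenius (x - y) = 0"
    by (simp add: frobenius_diff[OF assms])
  then show "x = y"
    by (simp add: frobenius_def)
qed

lemma K_frobenius_independent:
  fixes z :: "('n::finite \<Rightarrow>\<^sub>0 nat) \<Rightarrow> ('a::field, 'n) mfls"
  assumes prime: "prime CHAR('a)"
    and zero: "(\<Sum>r\<in>section_indices TYPE('a). t_power r * frobenius (z r)) = 0"
    and r: "r \<in> section_indices TYPE('a)"
  shows "z r = 0"
proof -
  let ?p = "CHAR('a)" and ?R = "section_indices TYPE('a) :: ('n \<Rightarrow>\<^sub>0 nat) set"
  have "finite ?R"
    by (rule finite_section_indices[OF prime_gt_0_nat[OF prime]])
  from common_denominator[OF this, of z]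
  obtain v u where v: "v \<noteq> 0" and u: "\<And>r. r \<in> ?R \<Longrightarrow> to_K v * z r = to_K (u r)"
    by blast
  have "to_K (\<Sum>r\<in>?R. mfps_monom 1 r * u r ^ ?p) = (\<Sum>r\<in>?R. t_power r * (to_K v * z r) ^ ?p)"
    by (simp add: to_K_sum to_K_mult to_K_power t_power_eq u)
  also have "\<dots> = to_K v ^ ?p * (\<Sum>r\<in>?R. t_power r * frobenius (z r))"
    by (simp add: sum_distrib_left power_mult_distrib frobenius_def mult.left_commute)
  finally have "(\<Sum>r\<in>?R. mfps_monom 1 r * u r ^ ?p) = 0"
    by (simp add: zero)
  then have "u r = 0"
    using r by (rule mfps_frobenius_independent[OF prime])
  with u[OF r] v show ?thesis
    by simp
qed

lemma section_op_eqI: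
  fixes z :: "('n::finite \<Rightarrow>\<^sub>0 nat) \<Rightarrow> ('a::field, 'n) mfls"
  assumes prime: "prime CHAR('a)"
    and g: "g = (\<Sum>r\<in>section_indices TYPE('a). t_power r * frobenius (z r))"
    and r: "r \<in> section_indices TYPE('a)"
  shows "section_op r g = z r"
proof -
  let ?R = "section_indices TYPE('a) :: ('n \<Rightarrow>\<^sub>0 nat) set"
  have "frobenius_coords g = (\<lambda>r. if r \<in> ?R then frobenius (z r) else 0)"
    unfolding frobenius_coords_def
  proof (rule the_equality)
    fix c assume c: "(\<forall>r\<in>?R. c r \<in> range frobenius) \<and> (\<forall>r. r \<notin> ?R \<longrightarrow> c r = 0) \<and>
      g = (\<Sum>r\<in>?R. t_power r * c r)"
    then have "\<forall>r\<in>?R. \<exists>y. c r = frobenius y"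
      by blast
    then obtain x where x: "\<forall>r\<in>?R. c r = frobenius (x r)"
      by (rule bchoice[THEN exE])
    have "(\<Sum>r\<in>?R. t_power r * frobenius (x r - z r))
        = (\<Sum>r\<in>?R. t_power r * frobenius (x r)) - (\<Sum>r\<in>?R. t_power r * frobenius (z r))"
      by (simp add: frobenius_diff[OF prime] right_diff_distrib sum_subtractf)
    also have "(\<Sum>r\<in>?R. t_power r * frobenius (x r)) = (\<Sum>r\<in>?R. t_power r * c r)"
      using x by (intro sum.cong) auto
    also have "\<dots> = (\<Sum>r\<in>?R. t_power r * frobenius (z r))"
      using c g by (elim conjE) (rule trans[OF sym])
    finally have "(\<Sum>r\<in>?R. t_power r * frobenius (x r - z r)) = 0"
      by (simp only: diff_self)
    then have "x r - z r = 0" if "r \<in> ?R" for r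
      using that by (rule K_frobenius_independent[OF prime])
    then have "c r = (if r \<in> ?R then frobenius (z r) else 0)" for r
      using c x by (cases "r \<in> ?R") simp_all
    then show "c = (\<lambda>r. if r \<in> ?R then frobenius (z r) else 0)"
      by (rule ext)
  next
    show "(\<forall>r\<in>?R. (if r \<in> ?R then frobenius (z r) else 0) \<in> range frobenius)
      \<and> (\<forall>r. r \<notin> ?R \<longrightarrow> (if r \<in> ?R then frobenius (z r) else 0) = 0)
      \<and> g = (\<Sum>r\<in>?R. t_power r * (if r \<in> ?R then frobenius (z r) else 0))"
      unfolding g by (auto intro!: sum.cong)
  qed
  with r show ?thesis
    by (simp add: section_op_def inv_f_f[OF inj_frobenius[OF prime]])
qed

lemma mfps_eq_sum_monom:
  fixes g :: "('a::comm_ring_1, 'n::finite) mfps"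
  assumes "finite I" "\<And>m. mfps_nth g m \<noteq> 0 \<Longrightarrow> m \<in> I"
  shows "g = (\<Sum>e\<in>I. mfps_const (mfps_nth g e) * mfps_monom 1 e)"
  by (rule mfps_eqI)
     (use assms in \<open>auto simp: nth_sum mfps_const_eq_monom mfps_monom_mult nth_mfps_monom\<close>)

lemma section_stable_space:
  fixes A :: "('a::field, 'n::finite) mfps poly"
  assumes perf: "perfect_field TYPE('a)" and prime: "prime CHAR('a)"
    and A: "A \<in> bounded_polys C d" "A \<noteq> 0" "poly A f = 0"
  defines "I \<equiv> {e. \<forall>(T, b)\<in>C. weight T e \<le> b}"
  assumes I: "finite I"
  shows "\<exists>W. K.subspace W \<and> (\<exists>B. finite B \<and> K.span B = W) \<and> K.dim W \<le> (d + 1) * card I \<and>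
    to_K f \<in> W \<and> (\<forall>\<omega>\<in>section_monoid. \<forall>w\<in>W. \<omega> w \<in> W)"
proof -
  let ?p = "CHAR('a)" and ?R = "section_indices TYPE('a) :: ('n \<Rightarrow>\<^sub>0 nat) set"
  have p: "?p > 0"
    using prime prime_gt_0_nat by blast
  obtain B where B: "B \<in> bounded_polys C d" "poly B f = 0" "poly (pderiv B) f \<noteq> 0"
    using separable_annihilator[OF perf prime A] .
  define a where "a = to_K (poly (pderiv B) f)"
  have a: "a \<noteq> 0"
    using B(3) by (simp add: a_def)
  define W where "W = (\<lambda>P. to_K (poly P f) / a) ` bounded_polys C d"
  define S where "S = (\<lambda>(j, e). to_K (mfps_monom 1 e * f ^ j) / a) ` ({..d} \<times> I)"
  have fin: "finite S"
    unfolding S_def using I by simp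
  have "card S \<le> card ({..d} \<times> I)"
    unfolding S_def using I by (intro card_image_le) simp
  then have card: "card S \<le> (d + 1) * card I"
    by (simp add: card_cartesian_product)
  have W_span: "W \<subseteq> K.span S"
  proof
    fix w assume "w \<in> W"
    then obtain P where P: "P \<in> bounded_polys C d" and w: "w = to_K (poly P f) / a"
      by (auto simp: W_def)
    have supp: "m \<in> I" if "mfps_nth (coeff P j) m \<noteq> 0" for j m
      using P that by (auto simp: bounded_polys_def I_def)
    have "poly P f = (\<Sum>j\<le>d. coeff P j * f ^ j)"
      unfolding poly_altdef using P
      by (intro sum.mono_neutral_left) (auto simp: bounded_polys_def coeff_eq_0)
    also have "\<dots> = (\<Sum>j\<le>d. (\<Sum>e\<in>I. mfps_const (mfps_nth (coeff P j) e) * mfps_monom 1 e) * f ^ j)"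
      by (intro sum.cong refl arg_cong2[where f = "(*)"] mfps_eq_sum_monom[OF I supp])
    finally have "w = (\<Sum>j\<le>d. \<Sum>e\<in>I. scale_K (mfps_nth (coeff P j) e) (to_K (mfps_monom 1 e * f ^ j) / a))"
      by (simp add: w sum_distrib_right sum_divide_distrib to_K_sum to_K_mult scale_K_def mult.assoc)
    also have "\<dots> \<in> K.span S"
      by (intro K.span_sum K.span_scale K.span_base) (auto simp: S_def)
    finally show "w \<in> K.span S" .
  qed
  have S_W: "S \<subseteq> W"
  proof
    fix w assume "w \<in> S"
    then obtain j e where je: "j \<le> d" "e \<in> I" "w = to_K (mfps_monom 1 e * f ^ j) / a"
      by (auto simp: S_def)
    let ?P = "monom (mfps_monom 1 e) j :: ('a, 'n) mfps poly"
    have "weight T m \<le> b" if "(T, b) \<in> C" "mfps_nth (coeff ?P i) m \<noteq> 0" for T b i m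
      using je(2) that by (auto simp: I_def nth_mfps_monom zero_mfps.rep_eq split: if_splits)
    moreover have "degree ?P \<le> d"
      using degree_monom_le je(1) by (rule order_trans)
    ultimately have "?P \<in> bounded_polys C d"
      unfolding bounded_polys_def by blast
    then show "w \<in> W"
      unfolding W_def by (rule rev_image_eqI) (simp add: je(3) poly_monom)
  qed
  have W: "K.subspace W"
  proof (rule K.subspaceI)
    have "0 \<in> bounded_polys C d"
      by (auto simp: bounded_polys_def zero_mfps.rep_eq)
    then show "0 \<in> W"
      unfolding W_def by (rule rev_image_eqI) simp
  next
    fix x y assume "x \<in> W" "y \<in> W"
    then obtain P Q where PQ: "P \<in> bounded_polys C d" "Q \<in> bounded_polys C d"
        and xy: "x = to_K (poly P f) / a" "y = to_K (poly Q f) / a"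
      unfolding W_def by blast
    have "mfps_nth (coeff (P + Q) j) m \<noteq> 0 \<Longrightarrow> mfps_nth (coeff P j) m \<noteq> 0 \<or> mfps_nth (coeff Q j) m \<noteq> 0" for j m
      by (auto simp: plus_mfps.rep_eq)
    moreover have "degree (P + Q) \<le> d"
      using PQ by (simp add: bounded_polys_def degree_add_le)
    ultimately have "P + Q \<in> bounded_polys C d"
      using PQ unfolding bounded_polys_def by blast
    then show "x + y \<in> W"
      unfolding W_def by (rule rev_image_eqI) (simp add: xy to_K_add add_divide_distrib)
  next
    fix c x assume "x \<in> W"
    then obtain P where P: "P \<in> bounded_polys C d" and x: "x = to_K (poly P f) / a"
      unfolding W_def by blast
    have "mfps_nth (coeff (smult (mfps_const c) P) j) m \<noteq> 0 \<Longrightarrow> mfps_nth (coeff P j) m \<noteq> 0" for j m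
      by (auto simp: nth_mfps_const_mult)
    moreover have "degree (smult (mfps_const c) P) \<le> d"
      using degree_smult_le order_trans P by (fastforce simp: bounded_polys_def)
    ultimately have "smult (mfps_const c) P \<in> bounded_polys C d"
      using P unfolding bounded_polys_def by blast
    then show "scale_K c x \<in> W"
      unfolding W_def by (rule rev_image_eqI) (simp add: x scale_K_def to_K_mult)
  qed
  have span: "K.span S = W"
    using W_span K.span_minimal[OF S_W W] by blast
  have "to_K f = to_K (poly (pCons 0 (pderiv B)) f) / a"
    using a by (simp add: a_def to_K_mult)
  then have f: "to_K f \<in> W"
    unfolding W_def using pderiv_in_bounded_polys(2)[OF B(1)] by blast
  have op: "section_op r w \<in> W" if r: "r \<in> ?R" and w: "w \<in> W" for r w
  proof -
    obtain P where P: "P \<in> bounded_polys C d" and w: "w = to_K (poly P f) / a"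
      using w unfolding W_def by blast
    let ?Q = "B ^ (?p - 1) * P"
    let ?D = "\<lambda>r. map_poly (mfps_section r) (contract ?p (?p - 1) ?Q)"
    have p_mult: "(?p - 1) * k + k = ?p * k" for k
      using p by (cases "?p") simp_all
    have wt: "weight_le T (?p * b) ?Q" if "(T, b) \<in> C" for T b
    proof -
      have "weight_le T b B" "weight_le T b P"
        using that B(1) P by (auto simp: bounded_polys_def)
      from weight_le_mult[OF weight_le_power[OF this(1)] this(2), of "?p - 1"] show ?thesis
        by (simp only: p_mult)
    qed
    have "degree ?Q \<le> degree (B ^ (?p - 1)) + degree P"
      by (rule degree_mult_le)
    also have "\<dots> \<le> degree B * (?p - 1) + degree P"
      by (intro add_right_mono degree_power_le)
    also have "\<dots> \<le> d * (?p - 1) + d"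
      using B(1) P by (intro add_mono mult_le_mono1) (simp_all add: bounded_polys_def)
    also have "\<dots> = ?p * d"
      by (simp only: p_mult mult.commute[of d])
    finally have D: "?D r \<in> bounded_polys C d" for r
      using wt by (intro section_in_bounded_polys[OF perf p])
    have "w = to_K (poly P f) * a ^ (?p - 1) / (a ^ (?p - 1) * a)"
      using a by (simp add: w)
    also have "\<dots> = to_K (poly P f * poly (pderiv B) f ^ (?p - 1)) / a ^ ?p"
      by (simp only: power_minus_mult[OF p] to_K_mult to_K_power a_def)
    also have "\<dots> = (\<Sum>r\<in>?R. t_power r * frobenius (to_K (poly (?D r) f) / a))"
      unfolding section_expansion_of_quotient[OF perf prime B(2)]
      by (simp add: to_K_sum to_K_mult to_K_power sum_divide_distrib t_power_eq frobenius_def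
          power_divide)
    finally have "section_op r w = to_K (poly (?D r) f) / a"
      using r by (rule section_op_eqI[OF prime])
    with D show ?thesis
      unfolding W_def by blast
  qed
  have closed: "\<forall>w\<in>W. \<omega> w \<in> W" if "\<omega> \<in> section_monoid" for \<omega>
    using that by induction (auto simp: op)
  have "K.dim W \<le> (d + 1) * card I"
    using K.dim_le_card[OF W_span fin] card by (rule order_trans)
  with W fin span f closed show ?thesis
    by blast
qed

lemma mfps_nth_mfps_of_mpoly: "mfps_nth (mfps_of_mpoly q) m = Poly_Mapping.lookup q m"
  by (simp add: mfps_of_mpoly_def Abs_mfps_inverse)

lemma mfps_of_mpoly_eq_0_iff: "mfps_of_mpoly q = (0 :: ('a::comm_ring_1, 'n::finite) mfps) \<longleftrightarrow> q = 0"
proof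
  assume "mfps_of_mpoly q = (0 :: ('a, 'n) mfps)"
  then show "q = 0"
    by (intro poly_mapping_eqI) (metis lookup_zero mfps_nth_mfps_of_mpoly zero_mfps.rep_eq)
qed (auto intro!: mfps_eqI simp: mfps_nth_mfps_of_mpoly zero_mfps.rep_eq)

theorem corollary1p4:
  fixes A :: "('a::field, 'n::finite) ty_poly"
    and f :: "('a, 'n) mfps"
    and p d h :: nat
    and hs :: "'n \<Rightarrow> nat"
  assumes "CHAR('a) = p" and "p > 0" and "perfect_field TYPE('a)"
    and "A \<noteq> 0"
    and "eval_y A f = 0"
    and "Polynomial.degree A \<le> d"
    and "deg_t A \<le> h"
    and "\<And>i. deg_t_var i A \<le> hs i"
  shows "\<exists>W :: ('a, 'n) mfls set.
           K.subspace W \<and>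
           (\<exists>B. finite B \<and> K.span B = W) \<and>
           K.dim W \<le> (d + 1) * min (\<Prod>i\<in>UNIV. hs i + 1) ((CARD('n) + h) choose CARD('n)) \<and>
           to_K f \<in> W \<and>
           (\<forall>\<omega>\<in>section_monoid. \<forall>w\<in>W. \<omega> w \<in> W)"
proof -
  have prime: "prime CHAR('a)"
    using assms(1,2) by (intro prime_CHAR_semidom) simp
  let ?A = "map_poly mfps_of_mpoly A :: ('a, 'n) mfps poly"
  have coeff: "coeff ?A j = mfps_of_mpoly (coeff A j)" for j
    by (simp add: coeff_map_poly mfps_of_mpoly_eq_0_iff)
  have A: "?A \<noteq> 0" "poly ?A f = 0"
    using assms(4,5) by (auto simp: poly_eq_iff coeff mfps_of_mpoly_eq_0_iff eval_y_def)
  have deg: "degree ?A \<le> d"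
    using assms(6) by (intro degree_le) (auto simp: coeff mfps_of_mpoly_eq_0_iff coeff_eq_0)
  have exps: "m \<in> t_exponents A" if "mfps_nth (coeff ?A j) m \<noteq> 0" for j m
    using that by (auto simp: coeff mfps_nth_mfps_of_mpoly t_exponents_def in_keys_iff)
  have simplex: "weight UNIV m \<le> h" if "m \<in> t_exponents A" for m
  proof -
    have "weight UNIV m \<le> deg_t A"
      unfolding weight_def deg_t_def using that finite_t_exponents by (intro Max_ge) auto
    with assms(7) show ?thesis by simp
  qed
  have box: "Poly_Mapping.lookup m i \<le> hs i" if "m \<in> t_exponents A" for m i
  proof -
    have "Poly_Mapping.lookup m i \<le> deg_t_var i A"
      unfolding deg_t_var_def using that finite_t_exponents by (intro Max_ge) auto
    with assms(8)[of i] show ?thesis by simp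
  qed
  have goal: ?thesis
    if C: "?A \<in> bounded_polys C d" and I: "{e. \<forall>(T, b)\<in>C. weight T e \<le> b} = I"
      and fin: "finite I" and card: "card I \<le> N"
      and N: "N = min (\<Prod>i\<in>UNIV. hs i + 1) ((CARD('n) + h) choose CARD('n))" for C N I
  proof -
    have "x \<le> (d + 1) * card I \<Longrightarrow> x \<le> (d + 1) * N" for x
      using mult_le_mono2[OF card] by (rule order_trans[rotated])
    then show ?thesis
      using section_stable_space[OF assms(3) prime C A, unfolded I, OF fin] unfolding N by blast
  qed
  show ?thesis
  proof (cases "(\<Prod>i\<in>UNIV. hs i + 1) \<le> (CARD('n) + h) choose CARD('n)")
    case True
    have "{e. \<forall>(T, b)\<in>range (\<lambda>i. ({i}, hs i)). weight T e \<le> b} = {e. \<forall>i. Poly_Mapping.lookup e i \<le> hs i}"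
      by (auto simp: weight_def)
    moreover have "?A \<in> bounded_polys (range (\<lambda>i. ({i}, hs i))) d"
      using deg box exps by (auto simp: bounded_polys_def weight_def)
    ultimately show ?thesis
      using exponents_box[of hs] True by (intro goal) auto
  next
    case False
    have "{e. \<forall>(T, b)\<in>{(UNIV, h)}. weight T e \<le> b} = {e :: 'n \<Rightarrow>\<^sub>0 nat. weight UNIV e \<le> h}"
      by auto
    moreover have "?A \<in> bounded_polys {(UNIV, h)} d"
      using deg simplex exps by (auto simp: bounded_polys_def)
    ultimately show ?thesis
      using exponents_simplex[where ?'n = 'n, of h] False by (intro goal) auto
  qed
qed

end
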